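(* For $n\ge 1$, let $g(n)$ be the maximum capture time among $n$-vertex strongly-connected directed graphs with cop number $1$. Then $g(n)=\Theta(n^2)$.
   Context: Cops and Robbers on a directed graph $D$: the cops first choose vertices, then the robber chooses a vertex; the game then proceeds in rounds, each consisting of a cop turn (each cop either stays put or moves along an out-edge of her current vertex) followed by a robber turn (the robber either stays put or moves along an out-edge). The cops win if some cop occupies the robber's vertex. The cop number is the least number of cops that can guarantee capture, and the capture time is the least $t$ such that that many cops can always capture the robber within $t$ rounds regardless of the robber's play (choosing initial positions does not count as a round). *)

theory Defs
  imports
    Complex_Main
    "HOL-Library.Landau_Symbols"
    "Graph_Theory.Digraph"
    "Graph_Theory.Digraph_Component"
begin

definition legal_move :: "('a, 'b) pre_digraph \<Rightarrow> 'a \<Rightarrow> 'a \<Rightarrow> bool" where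
  "legal_move D u v \<longleftrightarrow> v = u \<or> u \<rightarrow>\<^bsub>D\<^esub> v"

text \<open>
  A robber play \<open>r\<close> lists the robber's vertex \<open>r 0\<close> chosen at the start and his vertex
  \<open>r i\<close> after round \<open>i\<close>. Plays are continued forever; what happens after a capture
  is irrelevant, and the robber can always continue by staying put.
\<close>

definition robber_play :: "('a, 'b) pre_digraph \<Rightarrow> (nat \<Rightarrow> 'a) \<Rightarrow> bool" where
  "robber_play D r \<longleftrightarrow> r 0 \<in> verts D \<and> (\<forall>i. legal_move D (r i) (r (Suc i)))"

text \<open>
  A strategy of the cops maps the list of robber positions seen so far to the list of the
  vertices occupied by the cops (the entry at position \<open>j\<close> belongs to cop \<open>j\<close>). The empty
  history gives the initial placement. The cops' turn of round \<open>i + 1\<close> is played knowing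
  \<open>r 0, \<dots>, r i\<close>, so \<open>cops_at s r i\<close> is their placement after the cops' turn of round \<open>i\<close>
  (the initial placement for \<open>i = 0\<close>).
\<close>

type_synonym 'a cop_strategy = "'a list \<Rightarrow> 'a list"

definition cops_at :: "'a cop_strategy \<Rightarrow> (nat \<Rightarrow> 'a) \<Rightarrow> nat \<Rightarrow> 'a list" where
  "cops_at s r i = s (map r [0..<i])"

definition cop_strategy :: "('a, 'b) pre_digraph \<Rightarrow> nat \<Rightarrow> 'a cop_strategy \<Rightarrow> bool" where
  "cop_strategy D k s \<longleftrightarrow>
     length (s []) = k \<and> set (s []) \<subseteq> verts D \<and>
     (\<forall>r. robber_play D r \<longrightarrow>
        (\<forall>i. list_all2 (legal_move D) (cops_at s r i) (cops_at s r (Suc i))))"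

text \<open>
  Within \<open>t\<close> rounds, capture can occur at the initial placement or after the robber's turn
  of round \<open>i \<le> t\<close> (first disjunct), or after the cops' turn of round \<open>i + 1 \<le> t\<close>, when the
  robber is still at \<open>r i\<close> (second disjunct).
\<close>

definition captured_within :: "'a cop_strategy \<Rightarrow> (nat \<Rightarrow> 'a) \<Rightarrow> nat \<Rightarrow> bool" where
  "captured_within s r t \<longleftrightarrow>
     (\<exists>i\<le>t. r i \<in> set (cops_at s r i)) \<or> (\<exists>i<t. r i \<in> set (cops_at s r (Suc i)))"

definition cops_win :: "('a, 'b) pre_digraph \<Rightarrow> nat \<Rightarrow> bool" where
  "cops_win D k \<longleftrightarrow>
     (\<exists>s. cop_strategy D k s \<and> (\<forall>r. robber_play D r \<longrightarrow> (\<exists>t. captured_within s r t)))"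

definition cops_win_within :: "('a, 'b) pre_digraph \<Rightarrow> nat \<Rightarrow> nat \<Rightarrow> bool" where
  "cops_win_within D k t \<longleftrightarrow>
     (\<exists>s. cop_strategy D k s \<and> (\<forall>r. robber_play D r \<longrightarrow> captured_within s r t))"

definition cop_number :: "('a, 'b) pre_digraph \<Rightarrow> nat" where
  "cop_number D = (LEAST k. cops_win D k)"

definition capture_time :: "('a, 'b) pre_digraph \<Rightarrow> nat" where
  "capture_time D = (LEAST t. cops_win_within D (cop_number D) t)"

text \<open>
  Vertices are natural numbers and arcs are named by pairs of them. Every finite digraph
  without parallel arcs is isomorphic to one of this form, so this is no restriction; nor is
  excluding loops and parallel arcs, since they do not change the legal moves.
\<close>

definition max_capture_time :: "nat \<Rightarrow> nat" where
  "max_capture_time n =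
     Max {capture_time D | D :: (nat, nat \<times> nat) pre_digraph.
            digraph D \<and> strongly_connected D \<and> card (verts D) = n \<and> cop_number D = 1}"

end

theory Submission
  imports Defs
begin

text \<open>
  Upper bound: the set of positions (cop, robber) with the cop to move that are won within \<open>t\<close>
  rounds grows with \<open>t\<close> inside a set of size \<open>n\<^sup>2\<close> and is constant from the first \<open>t\<close> at which it
  does not grow.

  Lower bound: the robber lives on a long directed cycle \<open>0, \<dots>, N - 1\<close>, the cop on a second
  directed cycle of length \<open>2 * h\<close>. Of the robber's vertices \<open>1, \<dots>, 2 * h\<close>, one patrol vertex
  attacks the odd ones and the opposite patrol vertex the even ones, while \<open>2 * h + 1\<close> is always
  attacked. So each half lap of the cop gains exactly one vertex, and a capture takes about
  \<open>2 * h\<^sup>2\<close> rounds. The cop starts from \<open>0\<close>, which dominates everything outside \<open>1, \<dots>, 2 * h\<close>; she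
  cannot use \<open>0\<close> as a short cut between the two patrol vertices, since from the patrol cycle it is
  reached only along the remaining part of the long cycle, which takes longer than a lap.
\<close>

section \<open>Positional analysis of the game with one cop\<close>

text \<open>The cop is to move. The disjunct \<open>c' = r\<close> is a capture before the robber
  can reply; a robber who steps onto the cop is caught by \<open>c = r\<close> one level
  down.\<close>

primrec wins_in :: "('a, 'b) pre_digraph \<Rightarrow> nat \<Rightarrow> 'a \<Rightarrow> 'a \<Rightarrow> bool" where
  "wins_in D 0 c r \<longleftrightarrow> c = r"
| "wins_in D (Suc t) c r \<longleftrightarrow> c = r \<or> (\<exists>c'. legal_move D c c' \<and>
     (c' = r \<or> (\<forall>r'. legal_move D r r' \<longrightarrow> wins_in D t c' r')))"

lemma legal_move_refl [simp]: "legal_move D u u"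
  by (simp add: legal_move_def)

lemma legal_move_in_verts:
  assumes "wf_digraph D" "legal_move D u v" "u \<in> verts D"
  shows "v \<in> verts D"
  using assms wf_digraph.adj_in_verts(2) by (fastforce simp: legal_move_def)

lemma wins_in_self [simp]: "wins_in D t c c"
  by (cases t) auto

lemma wins_in_Suc: "wins_in D t c r \<Longrightarrow> wins_in D (Suc t) c r"
proof (induction t arbitrary: c r)
  case (Suc t)
  show ?case
  proof (cases "c = r")
    case False
    with Suc.prems obtain c' where "legal_move D c c'"
      "c' = r \<or> (\<forall>r'. legal_move D r r' \<longrightarrow> wins_in D t c' r')"
      by auto
    with Suc.IH show ?thesis
      unfolding wins_in.simps(2)[of D "Suc t"] by blast
  qed auto
qed simp

text \<open>The default \<open>u\<close> keeps the choice legal, so strategies built from it are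
  legal against all plays.\<close>

definition preferred_move :: "('a, 'b) pre_digraph \<Rightarrow> ('a \<Rightarrow> bool) \<Rightarrow> 'a \<Rightarrow> 'a" where
  "preferred_move D P u =
     (if \<exists>v. legal_move D u v \<and> P v then SOME v. legal_move D u v \<and> P v else u)"

lemma preferred_move_props:
  assumes "\<exists>v. legal_move D u v \<and> P v"
  shows "legal_move D u (preferred_move D P u)" "P (preferred_move D P u)"
  using someI_ex[OF assms] assms by (auto simp: preferred_move_def)

lemma legal_preferred_move [simp]: "legal_move D u (preferred_move D P u)"
proof (cases "\<exists>v. legal_move D u v \<and> P v")
  case True
  then show ?thesis by (rule preferred_move_props)
next
  case False
  then show ?thesis by (simp only: preferred_move_def if_False legal_move_refl)
qed

section \<open>Strategies with memory versus positions\<close>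

text \<open>Turns an invariant that the robber can restore after each cop move into an infinite play
  against \<open>s\<close>: as \<open>s\<close> is deterministic, each reply can be computed from
  the history.\<close>

lemma robber_evasion:
  assumes s: "cop_strategy D 1 s"
    and init: "\<And>c. c \<in> verts D \<Longrightarrow> \<exists>r\<in>verts D. I 0 c r"
    and step: "\<And>i c r c'. I i c r \<Longrightarrow> legal_move D c c' \<Longrightarrow>
                 \<exists>r'. legal_move D r r' \<and> I (Suc i) c' r'"
  obtains r c where "robber_play D r" "\<And>i. cops_at s r i = [c i]" "\<And>i. I i (c i) (r i)"
    "\<And>i. legal_move D (c i) (c (Suc i))"
proof -
  have "length (s []) = 1" and s0: "set (s []) \<subseteq> verts D"
    using s by (auto simp: cop_strategy_def)
  then obtain c0 where c0: "s [] = [c0]"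
    by (auto simp: length_Suc_conv)
  with s0 init obtain r0 where r0: "r0 \<in> verts D" "I 0 c0 r0"
    by auto
  \<comment> \<open>The recursion carries the whole history because \<open>s\<close> reads all of
    it; \<open>s (H i)\<close> is the placement to which robber position \<open>Suc i\<close>
    replies.\<close>
  define H where "H = rec_nat [r0] (\<lambda>i h. h @ [preferred_move D (I (Suc i) (hd (s h))) (last h)])"
  have H: "H 0 = [r0]" "H (Suc i) = H i @ [preferred_move D (I (Suc i) (hd (s (H i)))) (last (H i))]" for i
    by (simp_all add: H_def)
  define r where "r i = last (H i)" for i
  have Hr: "H i = map r [0..<Suc i]" for i
    by (induction i) (simp_all add: H r_def)
  have r_Suc: "r (Suc i) = preferred_move D (I (Suc i) (hd (cops_at s r (Suc i)))) (r i)" for i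
    by (simp add: r_def[of "Suc i"] H cops_at_def Hr[symmetric] r_def[of i] del: upt_Suc)
  have play: "robber_play D r"
    unfolding robber_play_def
  proof (intro conjI allI)
    show "r 0 \<in> verts D"
      using r0 by (simp add: r_def H)
    show "legal_move D (r i) (r (Suc i))" for i
      by (simp add: r_Suc)
  qed
  have cop_legal: "list_all2 (legal_move D) (cops_at s r i) (cops_at s r (Suc i))" for i
    using s play by (auto simp: cop_strategy_def)
  have "length (cops_at s r i) = 1" for i
  proof (induction i)
    case 0
    show ?case by (simp add: cops_at_def c0)
  next
    case (Suc i)
    then show ?case using cop_legal[of i] by (simp add: list_all2_lengthD)
  qed
  then have c: "cops_at s r i = [hd (cops_at s r i)]" for i
    by (metis One_nat_def length_0_conv length_Suc_conv list.sel(1))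
  define c' where "c' i = hd (cops_at s r i)" for i
  have c': "cops_at s r i = [c' i]" for i
    using c c'_def by simp
  have legal: "legal_move D (c' i) (c' (Suc i))" for i
    using cop_legal[of i] by (simp add: c')
  have "I i (c' i) (r i)" for i
  proof (induction i)
    case 0
    show ?case using r0 by (simp add: c'_def cops_at_def c0 r_def H)
  next
    case (Suc i)
    with step legal have "\<exists>r'. legal_move D (r i) r' \<and> I (Suc i) (c' (Suc i)) r'"
      by blast
    then show ?case
      unfolding r_Suc c'_def by (rule preferred_move_props)
  qed
  with play c' legal show ?thesis
    using that by blast
qed

lemma cops_win_within_imp_wins_in:
  assumes "cops_win_within D 1 t"
  obtains c where "c \<in> verts D" "\<And>r. r \<in> verts D \<Longrightarrow> wins_in D t c r"
proof (rule ccontr)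
  assume "\<not> thesis"
  with that have ex: "\<exists>r\<in>verts D. \<not> wins_in D t c r" if "c \<in> verts D" for c
    using \<open>c \<in> verts D\<close> by blast
  obtain s where s: "cop_strategy D 1 s"
    and win: "\<And>r. robber_play D r \<Longrightarrow> captured_within s r t"
    using assms by (auto simp: cops_win_within_def)
  obtain r c where r: "robber_play D r" "\<And>i. cops_at s r i = [c i]"
    "\<And>i. i \<le> t \<longrightarrow> \<not> wins_in D (t - i) (c i) (r i)" "\<And>i. legal_move D (c i) (c (Suc i))"
  \<comment> \<open>Past round \<open>t\<close> the difference \<open>t - i\<close> is truncated;
    the guard \<open>i \<le> t\<close> makes the invariant vacuous there.\<close>
  proof (rule robber_evasion[OF s, where I = "\<lambda>i c r. i \<le> t \<longrightarrow> \<not> wins_in D (t - i) c r"])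
    fix i c r c'
    assume "i \<le> t \<longrightarrow> \<not> wins_in D (t - i) c r" and "legal_move D c c'"
    then show "\<exists>r'. legal_move D r r' \<and> (Suc i \<le> t \<longrightarrow> \<not> wins_in D (t - Suc i) c' r')"
      using legal_move_refl[of D r]
      by (cases "i < t") (auto simp: Suc_diff_Suc[symmetric] simp del: legal_move_refl)
  qed (use ex in auto)
  have "r i \<noteq> c i" if "i \<le> t" for i
    using r(3)[of i] that by auto
  moreover have "r i \<noteq> c (Suc i)" if "i < t" for i
    using r(3)[of i] r(4)[of i] that by (auto simp: Suc_diff_Suc[symmetric])
  ultimately show False
    using win[OF r(1)] by (auto simp: captured_within_def r(2))
qed

lemma wins_in_imp_cops_win_within:
  assumes c0: "c0 \<in> verts D" and win: "\<And>r. r \<in> verts D \<Longrightarrow> wins_in D t c0 r"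
  shows "cops_win_within D 1 t"
proof -
  define good where "good m r c' \<longleftrightarrow> c' = r \<or> (\<forall>r'. legal_move D r r' \<longrightarrow> wins_in D m c' r')"
    for m r c'
  define move where "move m c r = preferred_move D (good m r) c" for m c r
  \<comment> \<open>On the reversed history the head is the newest robber position and
    \<open>length xs\<close> counts the completed rounds.\<close>
  define g where "g = rec_list c0 (\<lambda>x xs c. move (t - Suc (length xs)) c x)"
  have g: "g [] = c0" "g (x # xs) = move (t - Suc (length xs)) (g xs) x" for x xs
    by (simp_all add: g_def)
  define s where "s h = [g (rev h)]" for h
  define c where "c r i = g (rev (map r [0..<i]))" for r i
  have at: "cops_at s r i = [c r i]" for r i
    by (simp add: cops_at_def s_def c_def)
  have c_0: "c r 0 = c0" for r
    by (simp add: c_def g)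
  have c_Suc: "c r (Suc i) = move (t - Suc i) (c r i) (r i)" for r i
    by (simp add: c_def g)
  have "cop_strategy D 1 s"
    unfolding cop_strategy_def by (auto simp: at c_Suc move_def c0 g s_def)
  moreover have "captured_within s r t" if r: "robber_play D r" for r
  proof (rule ccontr)
    assume "\<not> captured_within s r t"
    then have free: "\<And>i. i \<le> t \<Longrightarrow> c r i \<noteq> r i" "\<And>i. i < t \<Longrightarrow> c r (Suc i) \<noteq> r i"
      by (auto simp: captured_within_def at)
    have "wins_in D (t - i) (c r i) (r i)" if "i \<le> t" for i
      using that
    proof (induction i)
      case 0
      show ?case using win r by (simp add: c_0 robber_play_def)
    next
      case (Suc i)
      then have "wins_in D (Suc (t - Suc i)) (c r i) (r i)"
        by (simp add: Suc_diff_Suc)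
      with free(1)[of i] Suc.prems have "good (t - Suc i) (r i) (c r (Suc i))"
        unfolding c_Suc move_def by (intro preferred_move_props) (auto simp: good_def)
      with free(2)[of i] Suc.prems r show ?case
        by (auto simp: good_def robber_play_def)
    qed
    from this[of t] free(1)[of t] show False by simp
  qed
  ultimately show ?thesis
    by (auto simp: cops_win_within_def)
qed

section \<open>A quadratic horizon for winning positions\<close>

lemma wins_in_stable:
  assumes wf: "wf_digraph D" and fin: "finite (verts D)" and V: "c \<in> verts D" "r \<in> verts D"
    and win: "wins_in D t c r"
  shows "wins_in D ((card (verts D))\<^sup>2) c r"
proof -
  define W where "W t = {(c, r) \<in> verts D \<times> verts D. wins_in D t c r}" for t
  let ?S = "verts D \<times> verts D"
  have sub: "W t \<subseteq> ?S" for t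
    by (auto simp: W_def)
  have finS: "finite ?S"
    using fin by simp
  have "mono W"
    unfolding mono_iff_le_Suc W_def by (auto dest: wins_in_Suc simp del: wins_in.simps)
  moreover have "finite (range W)"
    by (rule finite_subset[of _ "Pow ?S"]) (use sub finS in auto)
  \<comment> \<open>\<open>W (Suc n)\<close> is determined by \<open>W n\<close>, as legal moves
    stay inside \<open>verts D\<close>; so one repetition persists.\<close>
  moreover have "W (Suc n) = W (Suc (Suc n))" if eq: "W n = W (Suc n)" for n
  proof -
    have "wins_in D n c r = wins_in D (Suc n) c r" if "c \<in> verts D" "r \<in> verts D" for c r
      using eq that by (auto simp: W_def set_eq_iff)
    then have "wins_in D (Suc n) c r = wins_in D (Suc (Suc n)) c r"
      if "c \<in> verts D" "r \<in> verts D" for c r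
      using that legal_move_in_verts[OF wf] unfolding wins_in.simps(2)[of D _ c r] by blast
    then show ?thesis
      unfolding W_def by blast
  qed
  ultimately have "W (card ?S) = (\<Union>n. W n)"
    using sub finS
    by (intro finite_mono_strict_prefix_implies_finite_fixpoint
          finite_mono_remains_stable_implies_strict_prefix) auto
  moreover have "(c, r) \<in> W t"
    using V win by (simp add: W_def)
  ultimately have "(c, r) \<in> W (card ?S)"
    by blast
  then show ?thesis
    by (simp add: W_def card_cartesian_product power2_eq_square)
qed

text \<open>By stability, a position not won within the square bound is not won within one more
  round either, so the robber can remain among such positions forever.\<close>

lemma cops_win_imp_within_card_sq:
  assumes wf: "wf_digraph D" and fin: "finite (verts D)" and win: "cops_win D 1"
  shows "cops_win_within D 1 ((card (verts D))\<^sup>2)"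
proof (rule ccontr)
  let ?T = "(card (verts D))\<^sup>2"
  assume "\<not> ?thesis"
  then have ex: "\<exists>r\<in>verts D. \<not> wins_in D ?T c r" if "c \<in> verts D" for c
    using wins_in_imp_cops_win_within that by metis
  obtain s where s: "cop_strategy D 1 s"
    and win: "\<And>r. robber_play D r \<Longrightarrow> \<exists>t. captured_within s r t"
    using win by (auto simp: cops_win_def)
  define I where "I i c r \<longleftrightarrow> c \<in> verts D \<and> r \<in> verts D \<and> \<not> wins_in D ?T c r"
    for i :: nat and c r
  have move: "c' \<noteq> r \<and> (\<exists>r'. legal_move D r r' \<and> I (Suc i) c' r')"
    if I: "I i c r" and c': "legal_move D c c'" for i c r c'
  proof -
    have "\<not> wins_in D (Suc ?T) c r"
      using I wins_in_stable[OF wf fin, of c r "Suc ?T"] by (auto simp: I_def)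
    with c' have "c' \<noteq> r \<and> (\<exists>r'. legal_move D r r' \<and> \<not> wins_in D ?T c' r')"
      by auto
    then show ?thesis
      using legal_move_in_verts[OF wf] I c' by (auto simp: I_def)
  qed
  obtain r c where r: "robber_play D r" "\<And>i. cops_at s r i = [c i]" "\<And>i. I i (c i) (r i)"
    "\<And>i. legal_move D (c i) (c (Suc i))"
    by (rule robber_evasion[OF s, where I = I]) (use ex move in \<open>auto simp: I_def\<close>)
  have "r i \<noteq> c i" for i
    using r(3)[of i] by (auto simp: I_def)
  moreover have "r i \<noteq> c (Suc i)" for i
    using move[OF r(3) r(4), of i] by auto
  ultimately show False
    using win[OF r(1)] by (auto simp: captured_within_def r(2))
qed

text \<open>A cop on every vertex captures at once, so the \<open>LEAST\<close> is attained; on a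
  nonempty graph zero cops never capture.\<close>

lemma cop_number_eq_1_iff:
  assumes fin: "finite (verts D)" and ne: "verts D \<noteq> {}"
  shows "cop_number D = 1 \<longleftrightarrow> cops_win D 1"
proof
  obtain vs where vs: "set vs = verts D"
    using finite_list[OF fin] by blast
  have "list_all2 (legal_move D) vs vs"
    by (simp add: list_all2_refl)
  with vs have "cops_win D (length vs)"
    unfolding cops_win_def
    by (intro exI[of _ "\<lambda>_. vs"])
      (auto simp: cop_strategy_def cops_at_def captured_within_def robber_play_def intro!: exI[of _ 0])
  then show "cop_number D = 1 \<Longrightarrow> cops_win D 1"
    unfolding cop_number_def by (metis LeastI)
next
  assume win: "cops_win D 1"
  have "\<not> cops_win D 0"
  proof
    assume "cops_win D 0"
    then obtain s where s: "cop_strategy D 0 s"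
      and win: "\<And>r. robber_play D r \<Longrightarrow> \<exists>t. captured_within s r t"
      by (auto simp: cops_win_def)
    obtain v where v: "v \<in> verts D"
      using ne by blast
    define r where "r i = v" for i :: nat
    have r: "robber_play D r"
      using v by (simp add: robber_play_def r_def)
    have "cops_at s r i = []" for i
    proof (induction i)
      case 0
      show ?case using s by (simp add: cop_strategy_def cops_at_def)
    next
      case (Suc i)
      have "list_all2 (legal_move D) (cops_at s r i) (cops_at s r (Suc i))"
        using s r by (auto simp: cop_strategy_def)
      with Suc show ?case by simp
    qed
    with win[OF r] show False
      by (simp add: captured_within_def)
  qed
  with win show "cop_number D = 1"
    unfolding cop_number_def
    by (intro Least_equality) (auto simp: Suc_le_eq intro: Nat.gr0I)
qed

lemma capture_time_le:
  assumes "wf_digraph D" "finite (verts D)" "verts D \<noteq> {}" "cop_number D = 1"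
  shows "capture_time D \<le> (card (verts D))\<^sup>2"
  using assms cops_win_imp_within_card_sq[of D] cop_number_eq_1_iff[of D]
  unfolding capture_time_def by (auto intro: Least_le)

section \<open>A digraph with quadratic capture time\<close>

definition next_on_cycle :: "nat \<Rightarrow> nat \<Rightarrow> nat" where
  "next_on_cycle l i = (if Suc i = l then 0 else Suc i)"

lemma next_on_cycle_less: "i < l \<Longrightarrow> next_on_cycle l i < l"
  by (auto simp: next_on_cycle_def)

text \<open>
  Distance, along the patrol cycle of length \<open>2 * h\<close>, from position \<open>i\<close> to the position that
  attacks the vertices with the parity of \<open>k\<close>: position \<open>0\<close> for odd and \<open>h\<close> for even \<open>k\<close>.
\<close>

definition gap :: "nat \<Rightarrow> nat \<Rightarrow> nat \<Rightarrow> nat" where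
  "gap h k i = (if odd k then (if i = 0 then 0 else 2 * h - i)
                else (if i \<le> h then h - i else 3 * h - i))"

lemma gap_less: "i < 2 * h \<Longrightarrow> gap h k i < 2 * h"
  by (auto simp: gap_def)

lemma gap_next:
  "i < 2 * h \<Longrightarrow> 0 < gap h k i \<Longrightarrow> gap h k (next_on_cycle (2 * h) i) = gap h k i - 1"
  by (auto simp: gap_def next_on_cycle_def split: if_splits)

text \<open>The two attacking positions are antipodal, so a robber who escapes an attack by one step
  changes parity and is half a lap from the next attack.\<close>

lemma gap_Suc: "i < 2 * h \<Longrightarrow> gap h k i = 0 \<Longrightarrow> gap h (Suc k) i = h"
  by (auto simp: gap_def split: if_splits)

text \<open>
  The vertices below \<open>N\<close> form the escape cycle, \<open>N + i\<close> with \<open>i < 2 * h\<close> the patrol cycle.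
\<close>

definition arrow :: "nat \<Rightarrow> nat \<Rightarrow> nat \<Rightarrow> nat \<Rightarrow> bool" where
  "arrow h N u v \<longleftrightarrow>
     u < N \<and> v = next_on_cycle N u \<or>
     u = 0 \<and> 2 * h < v \<and> v < N + 2 * h \<or>
     (\<exists>i<2 * h. u = N + i \<and>
        (v = N + next_on_cycle (2 * h) i \<or> v = Suc (2 * h) \<or>
         1 \<le> v \<and> v \<le> 2 * h \<and> gap h v i = 0))"

definition patrol_digraph :: "nat \<Rightarrow> nat \<Rightarrow> (nat, nat \<times> nat) pre_digraph" where
  "patrol_digraph h N =
     \<lparr>verts = {..<N + 2 * h}, arcs = {(u, v). arrow h N u v}, tail = fst, head = snd\<rparr>"

section \<open>Arcs and strong connectivity\<close>

locale patrol =
  fixes h N :: nat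
  assumes h: "2 \<le> h" and N: "5 * h < N"
begin

abbreviation "D \<equiv> patrol_digraph h N"

lemma verts_D: "verts D = {..<N + 2 * h}"
  by (simp add: patrol_digraph_def)

lemma verts_D_nonempty: "verts D \<noteq> {}"
proof -
  have "0 \<in> verts D"
    using h by (simp add: verts_D)
  then show ?thesis by blast
qed

lemma arcs_ends_D: "arcs_ends D = {(u, v). arrow h N u v}"
  by (auto simp: patrol_digraph_def arcs_ends_conv)

lemma legal_move_D: "legal_move D u v \<longleftrightarrow> v = u \<or> arrow h N u v"
  by (auto simp: legal_move_def arcs_ends_D)

lemma arrow_in_verts: "arrow h N u v \<Longrightarrow> u < N + 2 * h \<and> v < N + 2 * h"
  using h N by (auto simp: arrow_def dest: next_on_cycle_less)

lemma arrow_irrefl: "\<not> arrow h N u u"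
  using h N by (auto simp: arrow_def next_on_cycle_def)

lemma digraph_D: "digraph D"
proof
  have "arcs D \<subseteq> verts D \<times> verts D"
    using arrow_in_verts by (auto simp: patrol_digraph_def)
  then show "finite (arcs D)"
    by (rule finite_subset) (simp add: verts_D)
qed (use arrow_in_verts arrow_irrefl in
      \<open>auto simp: patrol_digraph_def arc_to_ends_def\<close>)

lemma arrow_Suc: "Suc k < N \<Longrightarrow> arrow h N k (Suc k)"
  by (auto simp: arrow_def next_on_cycle_def)

lemma arrow_from_path: "0 < k \<Longrightarrow> k < N \<Longrightarrow> arrow h N k v \<longleftrightarrow> v = next_on_cycle N k"
  by (auto simp: arrow_def)

lemma arrow_from_0:
  "arrow h N 0 v \<longleftrightarrow> v = 1 \<or> 2 * h < v \<and> v < N \<or> (\<exists>i<2 * h. v = N + i)"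
proof -
  have "v < N + 2 * h \<longleftrightarrow> v < N \<or> (\<exists>i<2 * h. v = N + i)"
    by (metis add_less_cancel_left le_iff_add linorder_not_less trans_less_add1)
  then show ?thesis
    using h N by (auto simp: arrow_def next_on_cycle_def)
qed

lemma arrow_from_patrol:
  "i < 2 * h \<Longrightarrow> arrow h N (N + i) v \<longleftrightarrow>
     v = N + next_on_cycle (2 * h) i \<or> v = Suc (2 * h) \<or> 1 \<le> v \<and> v \<le> 2 * h \<and> gap h v i = 0"
  using h N by (auto simp: arrow_def)

text \<open>\<open>0\<close> is a hub: it lies on the escape cycle and has arcs to all patrol
  vertices, each of which has an arc back to that cycle.\<close>

lemma strongly_connected_D: "strongly_connected D"
proof -
  interpret digraph D
    by (rule digraph_D)
  have adj: "u \<rightarrow>\<^bsub>D\<^esub> v" if "arrow h N u v" for u v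
    using that by (simp add: arcs_ends_D)
  have from_0: "0 \<rightarrow>\<^sup>*\<^bsub>D\<^esub> k" if "k < N" for k
    using that
  proof (induction k)
    case 0
    show ?case using N by (intro reachable_refl) (simp add: verts_D)
  next
    case (Suc k)
    then show ?case
      using adj[OF arrow_Suc[of k]] by (auto intro: reachable_adj_trans)
  qed
  have to_0: "k \<rightarrow>\<^sup>*\<^bsub>D\<^esub> 0" if "k < N" for k
  proof -
    have "k \<le> N - 1" using that by simp
    then show ?thesis
    proof (induction k rule: inc_induct)
      case base
      have "arrow h N (N - 1) 0"
        using N by (auto simp: arrow_def next_on_cycle_def)
      then show ?case by (intro reachable_adjI adj)
    next
      case (step k)
      then have "k \<rightarrow>\<^bsub>D\<^esub> Suc k"
        by (intro adj arrow_Suc) simp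
      then show ?case
        using step.IH by (rule adj_reachable_trans)
    qed
  qed
  have from_0': "0 \<rightarrow>\<^sup>*\<^bsub>D\<^esub> v" if "v \<in> verts D" for v
  proof (cases "v < N")
    case False
    with that N have "arrow h N 0 v"
      by (auto simp: arrow_def verts_D)
    then show ?thesis by (intro reachable_adjI adj)
  qed (rule from_0)
  have to_0': "v \<rightarrow>\<^sup>*\<^bsub>D\<^esub> 0" if "v \<in> verts D" for v
  proof (cases "v < N")
    case False
    with that have "arrow h N (N + (v - N)) (Suc (2 * h))"
      by (subst arrow_from_patrol) (auto simp: verts_D)
    with False have "arrow h N v (Suc (2 * h))"
      by simp
    then show ?thesis
      using to_0[of "Suc (2 * h)"] h N by (auto intro: adj_reachable_trans adj)
  qed (rule to_0)
  show ?thesis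
  proof (rule strongly_connectedI)
    show "verts D \<noteq> {}" by (rule verts_D_nonempty)
    show "u \<rightarrow>\<^sup>*\<^bsub>D\<^esub> v" if "u \<in> verts D" "v \<in> verts D" for u v
      using to_0'[OF that(1)] from_0'[OF that(2)] by (rule reachable_trans)
  qed
qed

section \<open>A winning strategy for one cop\<close>

text \<open>The cop circles until she attacks. In each round either \<open>gap\<close> drops by one
  or the robber advances, which frees a weight \<open>3 * h\<close> exceeding any gap; so the bound
  is a decreasing potential. It is positive even at \<open>k = Suc (2 * h)\<close>, which rules out
  \<open>m = 0\<close>.\<close>

lemma wins_in_patrolling:
  "i < 2 * h \<Longrightarrow> 1 \<le> k \<Longrightarrow> k \<le> Suc (2 * h) \<Longrightarrow> 3 * h * (2 * h + 2 - k) + gap h k i \<le> m \<Longrightarrow>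
     wins_in D m (N + i) k"
proof (induction m arbitrary: i k)
  case 0
  then show ?case using h by auto
next
  case (Suc m)
  show ?case
  proof (cases "k = Suc (2 * h) \<or> gap h k i = 0")
    case True
    with Suc.prems have "legal_move D (N + i) k"
      by (auto simp: legal_move_D arrow_from_patrol)
    then show ?thesis by auto
  next
    case False
    let ?j = "next_on_cycle (2 * h) i"
    from False Suc.prems have k: "k \<le> 2 * h" and gap: "gap h k ?j = gap h k i - 1" "0 < gap h k i"
      by (auto simp: gap_next)
    have j: "?j < 2 * h"
      using Suc.prems by (intro next_on_cycle_less)
    have "3 * h * (2 * h + 2 - k) = 3 * h * (2 * h + 2 - Suc k) + 3 * h"
    proof -
      have "2 * h + 2 - k = Suc (2 * h + 2 - Suc k)"
        using k by simp
      then show ?thesis by simp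
    qed
    then have "wins_in D m (N + ?j) (Suc k)" "wins_in D m (N + ?j) k"
      using Suc.prems k gap j gap_less[OF j, of "Suc k"] by (auto intro!: Suc.IH)
    moreover have "r' = k \<or> r' = Suc k" if "legal_move D k r'" for r'
      using that k Suc.prems N by (auto simp: legal_move_D arrow_from_path next_on_cycle_def)
    moreover have "legal_move D (N + i) (N + ?j)"
      using Suc.prems by (simp add: legal_move_D arrow_from_patrol)
    ultimately show ?thesis by auto
  qed
qed

lemma cop_number_D: "cop_number D = 1"
proof -
  \<comment> \<open>Dominates the potential at patrol position \<open>0\<close>; one more round is
    the move from \<open>0\<close> to \<open>N\<close>.\<close>
  let ?m = "3 * h * (2 * h + 2) + 2 * h"
  have "wins_in D (Suc ?m) 0 r" if r: "r \<in> verts D" for r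
  proof -
    consider "r = 0" | "2 * h < r" | "1 \<le> r" "r \<le> 2 * h"
      by linarith
    then show ?thesis
    proof cases
      case 2
      with r have "legal_move D 0 r"
        by (auto simp: legal_move_D arrow_def verts_D)
      then show ?thesis by auto
    next
      case 3
      have "r' = r \<or> r' = Suc r" if "legal_move D r r'" for r'
        using that 3 N by (auto simp: legal_move_D arrow_from_path next_on_cycle_def)
      moreover have "wins_in D ?m (N + 0) k" if "1 \<le> k" "k \<le> Suc (2 * h)" for k
      proof (rule wins_in_patrolling)
        have "3 * h * (2 * h + 2 - k) \<le> 3 * h * (2 * h + 2)"
          by (intro mult_left_mono) auto
        then show "3 * h * (2 * h + 2 - k) + gap h k 0 \<le> ?m"
          using gap_less[of 0 h k] h by linarith
      qed (use that h in auto)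
      moreover have "legal_move D 0 N"
        using h by (auto simp: legal_move_D arrow_from_0 intro: exI[of _ 0])
      moreover have "1 \<le> r" "r \<le> Suc (2 * h)" "1 \<le> Suc r" "Suc r \<le> Suc (2 * h)"
        using 3 by auto
      ultimately show ?thesis
        unfolding wins_in.simps(2) add_0_right by blast
    qed simp
  qed
  then have "cops_win_within D 1 (Suc ?m)"
    using N by (intro wins_in_imp_cops_win_within[of 0]) (auto simp: verts_D)
  then have "cops_win D 1"
    by (auto simp: cops_win_def cops_win_within_def)
  then show ?thesis
    by (subst cop_number_eq_1_iff) (simp_all add: verts_D verts_D_nonempty[unfolded verts_D])
qed

section \<open>The robber's delaying strategy\<close>

text \<open>Counts cop moves, not laps: from \<open>k\<close> the robber can advance
  \<open>2 * h - k\<close> times, each time costing the cop \<open>h\<close> moves.\<close>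

definition laps :: "nat \<Rightarrow> nat" where
  "laps k = h * (2 * h - k)"

lemma laps_Suc: "k < 2 * h \<Longrightarrow> laps k = laps (Suc k) + h"
  by (simp add: laps_def Suc_diff_Suc[symmetric, of k "2 * h"])

lemma laps_antimono: "k \<le> l \<Longrightarrow> laps l \<le> laps k"
  unfolding laps_def by (intro mult_left_mono diff_le_mono2) auto

lemma laps_1: "laps (Suc 0) = laps 2 + h"
  using laps_Suc[of 1] h by (simp add: numeral_2_eq_2)

text \<open>
  With the cop at \<open>a\<close>, the robber at \<open>v\<close> and the cop to move, a capture takes at least \<open>m\<close>
  rounds. A cop on the escape cycle can only leave it through \<open>0\<close>; if she starts behind the robber,
  she thereby drives him all the way round to \<open>2\<close>, so that she has to begin anew. In the third case
  \<open>v = 0\<close> counts as \<open>v = N\<close>.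
\<close>

definition safe :: "nat \<Rightarrow> nat \<Rightarrow> nat \<Rightarrow> bool" where
  "safe m a v \<longleftrightarrow>
     a = 0 \<and> 2 \<le> v \<and> v \<le> 2 * h \<and> m \<le> laps v \<or>
     0 < a \<and> a < N \<and> 1 \<le> v \<and> v < a \<and> v \<le> 2 * h \<and> m \<le> laps (max v 2) + (N - a) \<or>
     0 < a \<and> a < N \<and> (a + 2 \<le> v \<and> v < N \<or> v = 0 \<and> a + 2 \<le> N) \<and> m \<le> laps 2 + (N - a) \<or>
     (\<exists>i<2 * h. a = N + i \<and> 1 \<le> v \<and> v \<le> 2 * h \<and> 0 < gap h v i \<and> m \<le> laps v + gap h v i)"

lemma safe_0I: "2 \<le> v \<Longrightarrow> v \<le> 2 * h \<Longrightarrow> m \<le> laps v \<Longrightarrow> safe m 0 v"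
  by (simp add: safe_def)

lemma safe_behindI:
  "a < N \<Longrightarrow> 1 \<le> v \<Longrightarrow> v < a \<Longrightarrow> v \<le> 2 * h \<Longrightarrow> m \<le> laps (max v 2) + (N - a) \<Longrightarrow> safe m a v"
  by (simp add: safe_def)

lemma safe_aheadI:
  "0 < a \<Longrightarrow> a < N \<Longrightarrow> a + 2 \<le> v \<and> v < N \<or> v = 0 \<and> a + 2 \<le> N \<Longrightarrow> m \<le> laps 2 + (N - a) \<Longrightarrow>
     safe m a v"
  by (simp add: safe_def)

lemma safe_patrolI:
  "i < 2 * h \<Longrightarrow> 1 \<le> v \<Longrightarrow> v \<le> 2 * h \<Longrightarrow> 0 < gap h v i \<Longrightarrow> m \<le> laps v + gap h v i \<Longrightarrow>
     safe m (N + i) v"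
  by (simp add: safe_def)

lemma safe_cases:
  assumes "safe m a v"
  obtains "a = 0" "2 \<le> v" "v \<le> 2 * h" "m \<le> laps v"
    | "0 < a" "a < N" "1 \<le> v" "v < a" "v \<le> 2 * h" "m \<le> laps (max v 2) + (N - a)"
    | "0 < a" "a < N" "a + 2 \<le> v \<and> v < N \<or> v = 0 \<and> a + 2 \<le> N" "m \<le> laps 2 + (N - a)"
    | i where "i < 2 * h" "a = N + i" "1 \<le> v" "v \<le> 2 * h" "0 < gap h v i"
        "m \<le> laps v + gap h v i"
  using assms unfolding safe_def by blast

lemma safe_mono:
  assumes "safe m a v" and m': "m' \<le> m"
  shows "safe m' a v"
  using assms(1)
proof (cases rule: safe_cases)
  case 1
  with m' show ?thesis by (auto intro: safe_0I)
next
  case 2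
  with m' show ?thesis by (intro safe_behindI) auto
next
  case 3
  with m' show ?thesis by (intro safe_aheadI) auto
next
  case (4 i)
  with m' show ?thesis by (auto intro: safe_patrolI)
qed

lemma safe_neq: "safe m a v \<Longrightarrow> a \<noteq> v"
  using h N by (auto simp: safe_def)

text \<open>The robber is to move. If attacked he advances, and the new gap \<open>h\<close> pays
  exactly for the drop in \<open>laps\<close>; \<open>0 < m\<close> excludes
  \<open>v = 2 * h\<close>, where \<open>laps\<close> vanishes.\<close>

lemma safe_patrolI_attacked:
  assumes "i < 2 * h" "1 \<le> v" "v \<le> 2 * h" "m \<le> laps v" "0 < m"
  shows "\<exists>v'. legal_move D v v' \<and> safe m (N + i) v'"
proof (cases "gap h v i = 0")
  case True
  have "v \<noteq> 2 * h"
    using assms by (auto simp: laps_def)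
  with assms have v: "v < 2 * h" by simp
  have "legal_move D v (Suc v)"
    using v N by (simp add: legal_move_D arrow_Suc)
  moreover have "safe m (N + i) (Suc v)"
    using v assms True gap_Suc[of i h v] laps_Suc[OF v] h by (intro safe_patrolI) auto
  ultimately show ?thesis by blast
next
  case False
  then have "safe m (N + i) v"
    using assms by (intro safe_patrolI) auto
  then show ?thesis
    using legal_move_refl[of D v] by blast
qed

lemma safe_step_from_0:
  assumes v: "2 \<le> v" "v \<le> 2 * h" "Suc m \<le> laps v" and m: "0 < m" and a': "arrow h N 0 a'"
  shows "a' \<noteq> v \<and> (\<exists>v'. legal_move D v v' \<and> safe m a' v')"
proof -
  from a' consider "a' = 1" | "2 * h < a'" "a' < N" | i where "i < 2 * h" "a' = N + i"
    unfolding arrow_from_0 by blast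
  then show ?thesis
  proof cases
    case 1
    \<comment> \<open>A robber waiting at \<open>2\<close> would be adjacent to the cop at
      \<open>1\<close>; stepping on secures distance two.\<close>
    have "legal_move D v (Suc v)"
      using v N by (simp add: legal_move_D arrow_Suc)
    moreover have "safe m 1 (Suc v)"
      using v N h laps_antimono[of 2 v] by (intro safe_aheadI) auto
    ultimately show ?thesis
      using 1 v by auto
  next
    case 2
    then have "safe m a' v"
      using v by (intro safe_behindI) (auto simp: max_def)
    then show ?thesis
      using 2 v legal_move_refl[of D v] by fastforce
  next
    case 3
    then show ?thesis
      using v m N safe_patrolI_attacked[of i v m] by auto
  qed
qed

lemma safe_step_behind:
  assumes a: "0 < a" "a < N" and v: "1 \<le> v" "v < a" "v \<le> 2 * h"
    and m: "Suc m \<le> laps (max v 2) + (N - a)"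
  shows "next_on_cycle N a \<noteq> v \<and> (\<exists>v'. legal_move D v v' \<and> safe m (next_on_cycle N a) v')"
proof (cases "Suc a = N")
  case True
  \<comment> \<open>The cop reaches \<open>0\<close>, which has an arc to \<open>1\<close>, so a
    robber at \<open>1\<close> must step to \<open>2\<close>; \<open>max v 2\<close> in the budget
    anticipates this.\<close>
  have "safe m 0 (max v 2)"
    using v m True h by (intro safe_0I) auto
  moreover have "legal_move D v (max v 2)"
  proof (cases "v = 1")
    case True
    then show ?thesis
      using h N arrow_Suc[of 1] by (simp add: legal_move_D numeral_2_eq_2)
  next
    case False
    with v have "max v 2 = v" by simp
    then show ?thesis by simp
  qed
  ultimately show ?thesis
    using True v by (auto simp: next_on_cycle_def)
next
  case False
  with a have "safe m (Suc a) v"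
    using v m by (intro safe_behindI) auto
  then show ?thesis
    using False v legal_move_refl[of D v] by (fastforce simp: next_on_cycle_def)
qed

lemma safe_step_ahead:
  assumes a: "0 < a" "a < N" and v: "a + 2 \<le> v \<and> v < N \<or> v = 0 \<and> a + 2 \<le> N"
    and m: "Suc m \<le> laps 2 + (N - a)"
  shows "next_on_cycle N a \<noteq> v \<and> (\<exists>v'. legal_move D v v' \<and> safe m (next_on_cycle N a) v')"
proof -
  have next_a: "next_on_cycle N a = Suc a" "Suc a < N"
    using v by (auto simp: next_on_cycle_def)
  \<comment> \<open>The robber waits until the distance is exactly two, then moves with the cop;
    stepping from \<open>0\<close> to \<open>1\<close> puts him behind her.\<close>
  consider "v \<noteq> 0" "a + 3 \<le> v" | "v = 0" "a + 3 \<le> N" | "v \<noteq> 0" "v = a + 2" | "v = 0" "N = a + 2"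
    using v by linarith
  then have "\<exists>v'. legal_move D v v' \<and> safe m (Suc a) v'"
  proof cases
    case 3
    then have "legal_move D v (next_on_cycle N v)"
      using v by (simp add: legal_move_D arrow_def)
    moreover have "safe m (Suc a) (next_on_cycle N v)"
      using 3 v m next_a by (intro safe_aheadI) (auto simp: next_on_cycle_def)
    ultimately show ?thesis by blast
  next
    case 4
    have "legal_move D 0 1"
      by (simp add: legal_move_D arrow_from_0)
    moreover have "safe m (Suc a) 1"
      using 4 a m h N by (intro safe_behindI) (auto simp: numeral_2_eq_2)
    ultimately show ?thesis
      unfolding \<open>v = 0\<close> by blast
  qed (use v m next_a in \<open>auto intro!: exI[of _ v] safe_aheadI\<close>)
  then show ?thesis
    using next_a v by auto
qed

lemma safe_step_from_patrol:
  assumes i: "i < 2 * h" and v: "1 \<le> v" "v \<le> 2 * h" "0 < gap h v i"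
    and m: "Suc m \<le> laps v + gap h v i" "0 < m" and a': "arrow h N (N + i) a'"
  shows "a' \<noteq> v \<and> (\<exists>v'. legal_move D v v' \<and> safe m a' v')"
proof -
  let ?j = "next_on_cycle (2 * h) i"
  have laps_2: "v = 1 \<or> laps v \<le> laps 2"
    using v laps_antimono[of 2 v] by linarith
  have laps: "laps v \<le> laps (max v 2) + h"
  proof (cases "v = 1")
    case True
    then show ?thesis using laps_1 by (simp add: numeral_2_eq_2)
  next
    case False
    with v have "max v 2 = v" by simp
    then show ?thesis by simp
  qed
  have gap: "gap h v i < 2 * h"
    using i by (rule gap_less)
  \<comment> \<open>From such \<open>a'\<close> the cop has at least \<open>3 * h\<close> steps to
    \<open>0\<close>, by \<open>5 * h < N\<close>. This covers the gap, below \<open>2 * h\<close>,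
    and the \<open>h\<close> lost when \<open>v = 1\<close> is counted as \<open>2\<close>.\<close>
  have behind: "\<exists>v'. legal_move D v v' \<and> safe m a' v'" if "v < a'" "a' \<le> Suc (2 * h)"
    using that v m laps gap N by (intro exI[of _ v] conjI safe_behindI) auto
  from a' i consider "a' = N + ?j" | "a' = Suc (2 * h)" | "1 \<le> a'" "a' \<le> 2 * h" "gap h a' i = 0"
    by (auto simp: arrow_from_patrol)
  then show ?thesis
  proof cases
    case 1
    have j: "?j < 2 * h"
      using i by (rule next_on_cycle_less)
    have "\<exists>v'. legal_move D v v' \<and> safe m (N + ?j) v'"
    proof (cases "gap h v i = 1")
      case True
      then show ?thesis
        using j v m by (intro safe_patrolI_attacked) auto
    next
      case False
      then show ?thesis
        using i j v m gap_next[of i h v] by (intro exI[of _ v] conjI safe_patrolI) auto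
    qed
    then show ?thesis
      using 1 v N by auto
  next
    case 2
    then show ?thesis
      using behind v by auto
  next
    case 3
    then have "a' \<noteq> v"
      using v by auto
    then consider "v < a'" | "v = Suc a'" | "Suc (Suc a') \<le> v"
      by linarith
    then show ?thesis
    proof cases
      case 1
      then show ?thesis using 3 behind by auto
    next
      case 2
      then have "legal_move D v (Suc v)" "safe m a' (Suc v)"
        using 3 v N m laps_2 gap by (auto simp: legal_move_D arrow_Suc intro!: safe_aheadI)
      with \<open>a' \<noteq> v\<close> show ?thesis by blast
    next
      case 3
      then have "safe m a' v"
        using \<open>1 \<le> a'\<close> v N m laps_2 gap by (intro safe_aheadI) auto
      then show ?thesis
        using legal_move_refl[of D v] \<open>a' \<noteq> v\<close> by blast
    qed
  qed
qed

lemma safe_step: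
  assumes safe: "safe (Suc m) a v" and m: "0 < m" and a': "legal_move D a a'"
  shows "a' \<noteq> v \<and> (\<exists>v'. legal_move D v v' \<and> safe m a' v')"
proof (cases "a' = a")
  case True
  have "safe m a v"
    using safe by (rule safe_mono) simp
  then show ?thesis
    unfolding True using safe_neq[OF safe] legal_move_refl[of D v] by blast
next
  case False
  with a' have arrow: "arrow h N a a'"
    by (simp add: legal_move_D)
  from safe show ?thesis
  proof (cases rule: safe_cases)
    case 1
    with arrow m show ?thesis by (intro safe_step_from_0) auto
  next
    case 2
    with arrow safe_step_behind[of a v m] show ?thesis by (simp add: arrow_from_path)
  next
    case 3
    with arrow safe_step_ahead[of a v m] show ?thesis by (simp add: arrow_from_path)
  next
    case (4 i)
    with arrow m show ?thesis by (intro safe_step_from_patrol[of i]) auto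
  qed
qed

text \<open>The shift by one makes the lower bound \<open>Suc t\<close> exclude capture within
  \<open>t\<close> rounds, and supplies the \<open>0 < m\<close> of
  \<open>safe_step\<close>.\<close>

lemma safe_imp_not_wins_in: "safe (Suc t) a v \<Longrightarrow> \<not> wins_in D t a v"
proof (induction t arbitrary: a v)
  case 0
  then show ?case using safe_neq by auto
next
  case (Suc t)
  then show ?case
    using safe_neq[OF Suc.prems] safe_step[OF Suc.prems zero_less_Suc]
    unfolding wins_in.simps(2) by blast
qed

lemma ex_safe:
  assumes a: "a \<in> verts D"
  obtains v where "v \<in> verts D" "safe (laps 2) a v"
proof -
  \<comment> \<open>Patrol position \<open>0\<close> is separated because it attacks
    \<open>1\<close>; there the robber starts at \<open>2\<close>. Against cops at \<open>1\<close>
    and \<open>2\<close> he starts at \<open>4\<close>, at distance two or more.\<close>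
  consider "a = 0" | "1 \<le> a" "a \<le> 2" | "3 \<le> a" "a < N" | i where "a = N + i" "0 < i" "i < 2 * h"
    | "a = N + 0"
    using a unfolding verts_D
    by (metis (no_types) One_nat_def Suc_leI add.right_neutral add_less_cancel_left le_iff_add
        lessThan_iff linorder_not_less neq0_conv not_less_eq_eq numeral_2_eq_2 numeral_3_eq_3)
  then show ?thesis
  proof cases
    case 1
    then show ?thesis
      using h N by (intro that[of 2]) (auto simp: verts_D intro: safe_0I)
  next
    case 2
    then show ?thesis
      using h N by (intro that[of 4]) (auto simp: verts_D intro!: safe_aheadI)
  next
    case 3
    then show ?thesis
      using h N by (intro that[of 1]) (auto simp: verts_D numeral_2_eq_2 intro!: safe_behindI)
  next
    case 4
    then have "safe (laps 2) a 1"
      unfolding \<open>a = N + i\<close> using h laps_1 by (intro safe_patrolI) (auto simp: gap_def)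
    then show ?thesis
      using N h by (intro that[of 1]) (auto simp: verts_D)
  next
    case 5
    have "safe (laps 2) a 2"
      unfolding 5 using h by (intro safe_patrolI) (auto simp: gap_def)
    then show ?thesis
      using N h by (intro that[of 2]) (auto simp: verts_D)
  qed
qed

lemma capture_time_D_ge: "laps 2 \<le> capture_time D"
proof (rule ccontr)
  assume "\<not> ?thesis"
  interpret digraph D
    by (rule digraph_D)
  have "cops_win D 1"
    using cop_number_D cop_number_eq_1_iff[OF finite_verts verts_D_nonempty] by simp
  \<comment> \<open>Some winning horizon must exist for the \<open>LEAST\<close> to be attained; the
    quadratic bound supplies one.\<close>
  then have "cops_win_within D 1 ((card (verts D))\<^sup>2)"
    by (intro cops_win_imp_within_card_sq wf_digraph finite_verts)
  then have "cops_win_within D 1 (capture_time D)"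
    unfolding capture_time_def cop_number_D by (rule LeastI)
  then obtain a where a: "a \<in> verts D" "\<And>v. v \<in> verts D \<Longrightarrow> wins_in D (capture_time D) a v"
    by (rule cops_win_within_imp_wins_in) blast
  obtain v where "v \<in> verts D" "safe (laps 2) a v"
    using a(1) by (rule ex_safe)
  with a(2) safe_mono[of "laps 2" a v "Suc (capture_time D)"] \<open>\<not> ?thesis\<close> show False
    using safe_imp_not_wins_in by auto
qed

end

section \<open>Combination of the two bounds\<close>

theorem theorem5p1:
  shows "(\<lambda>n. real (max_capture_time n)) \<in> \<Theta>(\<lambda>n. real n ^ 2)"
proof (rule bigthetaI')
  show "(1 / 256 :: real) > 0" "(1 :: real) > 0"
    by auto
  show "\<forall>\<^sub>F n in sequentially. 1 / 256 * norm (real n ^ 2) \<le> norm (real (max_capture_time n)) \<and>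
      norm (real (max_capture_time n)) \<le> 1 * norm (real n ^ 2)"
    using eventually_ge_at_top[of 16]
  proof eventually_elim
    case (elim n)
    define S where "S = {capture_time D | D :: (nat, nat \<times> nat) pre_digraph.
      digraph D \<and> strongly_connected D \<and> card (verts D) = n \<and> cop_number D = 1}"
    have S_le: "t \<le> n\<^sup>2" if "t \<in> S" for t
    proof -
      from that obtain D :: "(nat, nat \<times> nat) pre_digraph" where D: "t = capture_time D"
        "digraph D" "strongly_connected D" "card (verts D) = n" "cop_number D = 1"
        by (auto simp: S_def)
      interpret digraph D by fact
      show ?thesis
        using capture_time_le[OF wf_digraph finite_verts] D by (auto simp: strongly_connected_def)
    qed
    \<comment> \<open>Infinitely many vertex sets of naturals qualify, so finiteness for
      \<open>Max\<close> comes from the bound on the capture times.\<close>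
    then have fin: "finite S"
      by (intro finite_subset[of S "{..n\<^sup>2}"]) auto
    \<comment> \<open>For \<open>n \<ge> 16\<close> this gives \<open>h \<ge> 2\<close>, an escape
      cycle of at least \<open>6 * h\<close> vertices, and \<open>n \<le> 16 * h\<close>, whence the
      constant \<open>256\<close>.\<close>
    define h where "h = n div 8"
    have h_bounds: "2 \<le> h" "8 * h \<le> n" "n \<le> 16 * h"
      using elim by (auto simp: h_def)
    interpret patrol h "n - 2 * h"
      using h_bounds by unfold_locales auto
    have "capture_time D \<in> S"
      unfolding S_def using h_bounds digraph_D strongly_connected_D cop_number_D
      by (intro CollectI exI[of _ "patrol_digraph h (n - 2 * h)"]) (simp add: verts_D)
    then have max: "capture_time D \<le> Max S" "Max S \<in> S"
      using fin by (auto intro: Max_ge Max_in)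
    have "h * h \<le> h * (2 * h - 2)"
      using h_bounds by (intro mult_left_mono) auto
    with capture_time_D_ge max(1) have "h * h \<le> Max S"
      unfolding laps_def by linarith
    moreover have "n * n \<le> (16 * h) * (16 * h)"
      using h_bounds by (intro mult_mono) auto
    ultimately have "n\<^sup>2 \<le> 256 * Max S"
      by (simp add: power2_eq_square)
    then have "real (n\<^sup>2) \<le> real (256 * Max S)" "real (Max S) \<le> real (n\<^sup>2)"
      using S_le[OF max(2)] of_nat_mono by blast+
    then show ?case
      by (simp add: max_capture_time_def S_def)
  qed
qed

end
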